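(* Let $\mathcal{T}\in\mathbb{C}^{p\times q\times n}$, $\mathcal{B}\in\mathbb{C}^{q\times k\times n}$ and $\mathcal{C}\in\mathbb{C}^{s\times p\times n}$, and let $(\mathcal{C}*\mathcal{T}*\mathcal{B})^{(1)}$ be an arbitrary $\{1\}$-inverse of $\mathcal{C}*\mathcal{T}*\mathcal{B}$. Assume that the following conditions hold: (a) there exists a tensor $\mathcal{X}\in\mathbb{C}^{q\times p\times n}$ with $\mathcal{X}=\mathcal{T}^{(2)}_{\mathscr{R}(\mathcal{B}),\mathscr{N}(\mathcal{C})}$; (b) there exist $\mathcal{U},\mathcal{V}\in\mathbb{C}^{k\times s\times n}$ with $\mathcal{B}*\mathcal{U}*\mathcal{C}*\mathcal{T}*\mathcal{B}=\mathcal{B}$ and $\mathcal{C}*\mathcal{T}*\mathcal{B}*\mathcal{V}*\mathcal{C}=\mathcal{C}$; (c) there exist $\mathcal{Y}\in\mathbb{C}^{k\times p\times n}$ and $\mathcal{W}\in\mathbb{C}^{q\times s\times n}$ with $\mathcal{B}*\mathcal{Y}*\mathcal{T}*\mathcal{B}=\mathcal{B}$, $\mathcal{C}*\mathcal{T}*\mathcal{W}*\mathcal{C}=\mathcal{C}$ and $\mathcal{B}*\mathcal{Y}=\mathcal{W}*\mathcal{C}$; (d) there exist $\mathcal{U}\in\mathbb{C}^{k\times p\times n}$ and $\mathcal{V}\in\mathbb{C}^{q\times s\times n}$ with $\mathcal{C}*\mathcal{T}*\mathcal{B}*\mathcal{U}=\mathcal{C}$ and $\mathcal{V}*\mathcal{C}*\mathcal{T}*\mathcal{B}=\mathcal{B}$;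 (e) $\mathscr{R}(\mathcal{C}*\mathcal{T}*\mathcal{B})=\mathscr{R}(\mathcal{C})$ and $\mathscr{N}(\mathcal{C}*\mathcal{T}*\mathcal{B})=\mathscr{N}(\mathcal{B})$; (f) $\mathcal{B}*(\mathcal{C}*\mathcal{T}*\mathcal{B})^{(1)}*\mathcal{C}*\mathcal{T}*\mathcal{B}=\mathcal{B}$ and $\mathcal{C}*\mathcal{T}*\mathcal{B}*(\mathcal{C}*\mathcal{T}*\mathcal{B})^{(1)}*\mathcal{C}=\mathcal{C}$; (g) $\mathrm{rank}_t(\mathcal{C}*\mathcal{T}*\mathcal{B})=\mathrm{rank}_t(\mathcal{B})=\mathrm{rank}_t(\mathcal{C})$. Then $$\mathcal{T}^{(2)}_{\mathscr{R}(\mathcal{B}),\mathscr{N}(\mathcal{C})}=\mathcal{B}*(\mathcal{C}*\mathcal{T}*\mathcal{B})^{(1)}*\mathcal{C}=\mathcal{B}*\mathcal{Z}*\mathcal{C}$$ for every $\mathcal{Z}\in\mathbb{C}^{k\times s\times n}$ satisfying $\mathcal{B}*\mathcal{Z}*\mathcal{C}*\mathcal{T}*\mathcal{B}=\mathcal{B}$ and $\mathcal{C}*\mathcal{T}*\mathcal{B}*\mathcal{Z}*\mathcal{C}=\mathcal{C}$.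
   Context: A third-order tensor $\mathcal{A}\in\mathbb{C}^{a\times b\times n}$ has frontal slices $A_1,\dots,A_n\in\mathbb{C}^{a\times b}$, $A_k=\mathcal{A}(:,:,k)$. $\mathrm{bcirc}(\mathcal{A})\in\mathbb{C}^{an\times bn}$ is the block circulant matrix whose $(i,j)$ block ($1\le i,j\le n$) is $A_{((i-j)\bmod n)+1}$. For $\mathcal{A}\in\mathbb{C}^{a\times b\times n}$ and $\mathcal{B}\in\mathbb{C}^{b\times c\times n}$, the $t$-product $\mathcal{A}*\mathcal{B}\in\mathbb{C}^{a\times c\times n}$ is the unique tensor with $\mathrm{bcirc}(\mathcal{A}*\mathcal{B})=\mathrm{bcirc}(\mathcal{A})\,\mathrm{bcirc}(\mathcal{B})$. The $t$-range space $\mathscr{R}(\mathcal{A})$ is the range (column space) of $\mathrm{bcirc}(\mathcal{A})$, the $t$-null space $\mathscr{N}(\mathcal{A})$ is the null space of $\mathrm{bcirc}(\mathcal{A})$, and $\mathrm{rank}_t(\mathcal{A})=\mathrm{rank}(\mathrm{bcirc}(\mathcal{A}))$. A $\{1\}$-inverse of $\mathcal{A}\in\mathbb{C}^{a\times b\times n}$ is a tensor $\mathcal{X}\in\mathbb{C}^{b\times a\times n}$ with $\mathcal{A}*\mathcal{X}*\mathcal{A}=\mathcal{A}$. For $\mathcal{T}\in\mathbb{C}^{p\times q\times n}$, $\mathcal{T}^{(2)}_{\mathscr{R}(\mathcal{B}),\mathscr{N}(\mathcal{C})}$ denotes the tensor $\mathcal{X}\in\mathbb{C}^{q\times p\times n}$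 (unique if it exists) with $\mathcal{X}*\mathcal{T}*\mathcal{X}=\mathcal{X}$, $\mathscr{R}(\mathcal{X})=\mathscr{R}(\mathcal{B})$ and $\mathscr{N}(\mathcal{X})=\mathscr{N}(\mathcal{C})$. *)

theory Defs
  imports Jordan_Normal_Form.DL_Rank Jordan_Normal_Form.Matrix_Kernel Complex_Main
begin

text \<open>A third-order tensor of size \<open>a \<times> b \<times> n\<close> is the list of its \<open>n\<close> frontal slices,
  each an \<open>a \<times> b\<close> matrix.  Indices are 0-based, so \<open>A ! k\<close> is the slice written
  \<open>A\<^sub>k\<^sub>+\<^sub>1\<close> in 1-based notation.\<close>

type_synonym tensor = "complex mat list"

definition carrier_tensor :: "nat \<Rightarrow> nat \<Rightarrow> nat \<Rightarrow> tensor set" where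
  "carrier_tensor a b n = {A. length A = n \<and> set A \<subseteq> carrier_mat a b}"

text \<open>The slice dimensions are read off the first slice; they are meaningful for \<open>n > 0\<close> only.\<close>

definition t_rows :: "tensor \<Rightarrow> nat" where
  "t_rows A = dim_row (A ! 0)"

definition t_cols :: "tensor \<Rightarrow> nat" where
  "t_cols A = dim_col (A ! 0)"

text \<open>\<open>cyc n i j\<close> is \<open>(i - j) mod n\<close>, computed in the integers to avoid truncated subtraction.\<close>

definition cyc :: "nat \<Rightarrow> nat \<Rightarrow> nat \<Rightarrow> nat" where
  "cyc n i j = nat ((int i - int j) mod int n)"

definition bcirc :: "tensor \<Rightarrow> complex mat" where
  "bcirc A = (let a = t_rows A; b = t_cols A; n = length A in
     mat (a * n) (b * n) (\<lambda>(i, j). A ! cyc n (i div a) (j div b) $$ (i mod a, j mod b)))"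

text \<open>Existence and uniqueness of the tensor described here are established in
  \<open>t_prod_ex1\<close> below, for operands of matching sizes and \<open>n > 0\<close>.\<close>

definition t_prod :: "tensor \<Rightarrow> tensor \<Rightarrow> tensor"  (infixl "*\<^sub>t" 70) where
  "A *\<^sub>t B = (THE C. C \<in> carrier_tensor (t_rows A) (t_cols B) (length A)
                 \<and> bcirc C = bcirc A * bcirc B)"

definition t_range :: "tensor \<Rightarrow> complex vec set" where
  "t_range A = vec_space.col_space (dim_row (bcirc A)) (bcirc A)"

definition t_null :: "tensor \<Rightarrow> complex vec set" where
  "t_null A = mat_kernel (bcirc A)"

definition t_rank :: "tensor \<Rightarrow> nat" where
  "t_rank A = vec_space.rank (dim_row (bcirc A)) (bcirc A)"

definition is_one_inverse :: "tensor \<Rightarrow> tensor \<Rightarrow> bool" where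
  "is_one_inverse A X \<longleftrightarrow>
     X \<in> carrier_tensor (t_cols A) (t_rows A) (length A) \<and> A *\<^sub>t X *\<^sub>t A = A"

definition is_outer_inverse :: "tensor \<Rightarrow> tensor \<Rightarrow> tensor \<Rightarrow> tensor \<Rightarrow> bool" where
  "is_outer_inverse T B C X \<longleftrightarrow>
     X \<in> carrier_tensor (t_cols T) (t_rows T) (length T) \<and>
     X *\<^sub>t T *\<^sub>t X = X \<and> t_range X = t_range B \<and> t_null X = t_null C"

text \<open>Uniqueness is \<open>is_outer_inverse_unique\<close> below; if no such tensor exists,
  the value is unspecified.\<close>

definition outer_inverse :: "tensor \<Rightarrow> tensor \<Rightarrow> tensor \<Rightarrow> tensor" where
  "outer_inverse T B C = (THE X. is_outer_inverse T B C X)"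


lemma carrier_tensor_nth:
  "A \<in> carrier_tensor a b n \<Longrightarrow> k < n \<Longrightarrow> A ! k \<in> carrier_mat a b"
  by (auto simp: carrier_tensor_def)

lemma carrier_tensor_dims:
  assumes "A \<in> carrier_tensor a b n" "0 < n"
  shows "t_rows A = a" "t_cols A = b" "length A = n"
  using carrier_tensor_nth[OF assms] assms(1)
  by (auto simp: t_rows_def t_cols_def carrier_tensor_def)

lemma cyc_less: "0 < n \<Longrightarrow> cyc n i j < n"
  by (simp add: cyc_def nat_less_iff)

lemma bcirc_eq:
  assumes "A \<in> carrier_tensor a b n" "0 < n"
  shows "bcirc A = mat (a * n) (b * n)
     (\<lambda>(i, j). A ! cyc n (i div a) (j div b) $$ (i mod a, j mod b))"
  by (simp add: bcirc_def carrier_tensor_dims[OF assms])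

lemma bcirc_carrier:
  assumes "A \<in> carrier_tensor a b n" "0 < n"
  shows "bcirc A \<in> carrier_mat (a * n) (b * n)"
  by (simp add: bcirc_eq[OF assms])

lemma bcirc_inj:
  assumes A: "A \<in> carrier_tensor a b n" and B: "B \<in> carrier_tensor a b n"
    and n: "0 < n" and eq: "bcirc A = bcirc B"
  shows "A = B"
proof (rule nth_equalityI)
  show "length A = length B" using A B by (simp add: carrier_tensor_def)
  fix k assume "k < length A"
  then have k: "k < n" using A by (simp add: carrier_tensor_def)
  note cA = carrier_tensor_nth[OF A k] and cB = carrier_tensor_nth[OF B k]
  show "A ! k = B ! k"
  proof (rule eq_matI)
    fix i j assume "i < dim_row (B ! k)" "j < dim_col (B ! k)"
    then have i: "i < a" and j: "j < b" using cB by auto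
    have "k * a + i < Suc k * a" using i by simp
    also have "\<dots> \<le> n * a" using k by (intro mult_right_mono) auto
    finally have I: "k * a + i < a * n" by (simp add: mult.commute)
    have "j < b * 1" using j by simp
    also have "\<dots> \<le> b * n" using n by (intro mult_left_mono) auto
    finally have J: "j < b * n" .
    have "cyc n k 0 = k" using k by (simp add: cyc_def)
    then show "A ! k $$ (i, j) = B ! k $$ (i, j)"
      using arg_cong[OF eq, of "\<lambda>M. M $$ (k * a + i, j)"] I J i j
      by (simp add: bcirc_eq[OF A n] bcirc_eq[OF B n])
  qed (use cA cB in auto)
qed

lemma cyc_cyc:
  assumes "0 < n"
  shows "cyc n (cyc n i j) (cyc n l j) = cyc n i l"
  using assms by (simp add: cyc_def mod_simps)

lemma bij_betw_cyc:
  assumes n: "0 < n"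
  shows "bij_betw (\<lambda>l. cyc n l j) {..<n} {..<n}"
proof -
  have "inj_on (\<lambda>l. cyc n l j) {..<n}"
  proof (rule inj_onI)
    fix x y assume x: "x \<in> {..<n}" and y: "y \<in> {..<n}" and e: "cyc n x j = cyc n y j"
    have "(int x - int j) mod int n = (int y - int j) mod int n"
      using e n by (simp add: cyc_def nat_eq_iff)
    then have "int x mod int n = int y mod int n"
      by (metis diff_add_cancel mod_add_cong)
    then show "x = y" using x y by simp
  qed
  moreover have "(\<lambda>l. cyc n l j) ` {..<n} \<subseteq> {..<n}" using cyc_less[OF n] by auto
  ultimately show ?thesis
    by (simp add: bij_betw_def endo_inj_surj)
qed

lemma sum_blocks:
  fixes f :: "nat \<Rightarrow> nat \<Rightarrow> 'a :: comm_monoid_add"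
  shows "(\<Sum>x<b * n. f (x div b) (x mod b)) = (\<Sum>l<n. \<Sum>t<b. f l t)"
proof (cases "b = 0")
  case False
  have "(\<Sum>x<b * n. f (x div b) (x mod b))
      = (\<Sum>l<n. \<Sum>x\<in>{l * b..<l * b + b}. f (x div b) (x mod b))"
    by (simp add: sum.nat_group mult.commute)
  also have "\<dots> = (\<Sum>l<n. \<Sum>t<b. f l t)"
  proof (rule sum.cong[OF refl])
    fix l
    have "(\<Sum>x\<in>{0 + l * b..<b + l * b}. f (x div b) (x mod b))
        = (\<Sum>t\<in>{0..<b}. f ((t + l * b) div b) ((t + l * b) mod b))"
      by (rule sum.shift_bounds_nat_ivl)
    also have "\<dots> = (\<Sum>t<b. f l t)"
      using False by (simp add: atLeast0LessThan)
    finally show "(\<Sum>x\<in>{l * b..<l * b + b}. f (x div b) (x mod b)) = (\<Sum>t<b. f l t)"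
      by (simp add: add.commute)
  qed
  finally show ?thesis .
qed simp

lemma t_prod_ex1:
  assumes A: "A \<in> carrier_tensor a b n" and B: "B \<in> carrier_tensor b c n" and n: "0 < n"
  shows "\<exists>!C. C \<in> carrier_tensor a c n \<and> bcirc C = bcirc A * bcirc B"
proof (rule ex_ex1I)
  define C where "C = map (\<lambda>k. mat a c (\<lambda>(r, s).
    \<Sum>l<n. \<Sum>t<b. A ! cyc n k l $$ (r, t) * B ! l $$ (t, s))) [0..<n]"
  have C: "C \<in> carrier_tensor a c n" by (auto simp: carrier_tensor_def C_def)
  have "bcirc C = bcirc A * bcirc B"
  proof (rule eq_matI)
    fix i j assume "i < dim_row (bcirc A * bcirc B)" "j < dim_col (bcirc A * bcirc B)"
    then have i: "i < a * n" and j: "j < c * n"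
      by (auto simp: bcirc_eq[OF A n] bcirc_eq[OF B n])
    then have im: "i mod a < a" and jm: "j mod c < c" by (auto intro!: mod_less_divisor Nat.gr0I)
    define p q where "p = i div a" and "q = j div c"
    let ?r = "i mod a" and ?s = "j mod c"
    have "(bcirc A * bcirc B) $$ (i, j)
        = (\<Sum>x<b * n. A ! cyc n p (x div b) $$ (?r, x mod b) * B ! cyc n (x div b) q $$ (x mod b, ?s))"
      using i j by (simp add: bcirc_eq[OF A n] bcirc_eq[OF B n] scalar_prod_def p_def q_def atLeast0LessThan)
    also have "\<dots> = (\<Sum>l<n. \<Sum>t<b. A ! cyc n p l $$ (?r, t) * B ! cyc n l q $$ (t, ?s))"
      by (rule sum_blocks)
    also have "\<dots> = (\<Sum>l<n. \<Sum>t<b. A ! cyc n (cyc n p q) (cyc n l q) $$ (?r, t) * B ! cyc n l q $$ (t, ?s))"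
      by (simp add: cyc_cyc[OF n])
    also have "\<dots> = (\<Sum>l<n. \<Sum>t<b. A ! cyc n (cyc n p q) l $$ (?r, t) * B ! l $$ (t, ?s))"
      by (rule sum.reindex_bij_betw[OF bij_betw_cyc[OF n]])
    also have "\<dots> = bcirc C $$ (i, j)"
    proof -
      have "bcirc C $$ (i, j) = C ! cyc n p q $$ (?r, ?s)"
        using i j by (simp add: bcirc_eq[OF C n] p_def q_def)
      then show ?thesis using im jm cyc_less[OF n, of p q] by (simp add: C_def)
    qed
    finally show "bcirc C $$ (i, j) = (bcirc A * bcirc B) $$ (i, j)" ..
  qed (auto simp: bcirc_eq[OF A n] bcirc_eq[OF B n] bcirc_eq[OF C n])
  with C show "\<exists>C. C \<in> carrier_tensor a c n \<and> bcirc C = bcirc A * bcirc B" by blast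
qed (metis bcirc_inj n)

lemma t_prod_props:
  assumes A: "A \<in> carrier_tensor a b n" and B: "B \<in> carrier_tensor b c n" and n: "0 < n"
  shows "A *\<^sub>t B \<in> carrier_tensor a c n" "bcirc (A *\<^sub>t B) = bcirc A * bcirc B"
  using theI'[OF t_prod_ex1[OF assms]]
  by (simp_all add: t_prod_def carrier_tensor_dims[OF A n] carrier_tensor_dims[OF B n])

lemma t_range_eq:
  "t_range A = {bcirc A *\<^sub>v x | x. x \<in> carrier_vec (dim_col (bcirc A))}"
  using vec_space.col_space_eq[of "bcirc A" "dim_row (bcirc A)" "dim_col (bcirc A)"]
  by (auto simp: t_range_def intro!: mult_mat_vec_carrier)

lemma mult_unit_vec_col:
  fixes A :: "complex mat"
  assumes "A \<in> carrier_mat q p" "j < p"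
  shows "A *\<^sub>v unit_vec p j = col A j"
  using assms by (intro eq_vecI) auto

lemma outer_absorb_left:
  fixes X Y T :: "complex mat"
  assumes X: "X \<in> carrier_mat q p" and Y: "Y \<in> carrier_mat q p" and T: "T \<in> carrier_mat p q"
    and YTY: "Y * T * Y = Y"
    and R: "\<And>x. x \<in> carrier_vec p \<Longrightarrow> \<exists>y\<in>carrier_vec p. X *\<^sub>v x = Y *\<^sub>v y"
  shows "Y * T * X = X"
proof (rule eq_matI)
  fix i j assume "i < dim_row X" and "j < dim_col X"
  then have i: "i < q" and j: "j < p" using X by auto
  obtain y where y: "y \<in> carrier_vec p" "X *\<^sub>v unit_vec p j = Y *\<^sub>v y"
    using R[OF unit_vec_carrier] by blast
  have "(Y * T * X) *\<^sub>v unit_vec p j = (Y * T) *\<^sub>v (Y *\<^sub>v y)"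
    using assoc_mult_mat_vec[of "Y * T" q q X p "unit_vec p j"] X Y T y by simp
  also have "\<dots> = X *\<^sub>v unit_vec p j"
    using X Y T y YTY assoc_mult_mat_vec[of "Y * T" q q Y p y] by simp
  finally have "col (Y * T * X) j = col X j"
    using X Y T j by (simp add: mult_unit_vec_col[of _ q p])
  then show "(Y * T * X) $$ (i, j) = X $$ (i, j)"
    using X Y T i j by (metis carrier_matD index_col index_mult_mat(2,3))
qed (use X Y T in auto)

lemma outer_absorb_right:
  fixes X Y T :: "complex mat"
  assumes X: "X \<in> carrier_mat q p" and Y: "Y \<in> carrier_mat q p" and T: "T \<in> carrier_mat p q"
    and YTY: "Y * T * Y = Y" and N: "mat_kernel Y \<subseteq> mat_kernel X"
  shows "X * T * Y = X"
proof (rule eq_matI)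
  fix i j assume "i < dim_row X" and "j < dim_col X"
  then have i: "i < q" and j: "j < p" using X by auto
  let ?e = "unit_vec p j :: complex vec"
  let ?d = "?e - (T * Y) *\<^sub>v ?e"
  have e: "?e \<in> carrier_vec p" and TY: "T * Y \<in> carrier_mat p p" using T Y by auto
  then have TYe: "(T * Y) *\<^sub>v ?e \<in> carrier_vec p" by (rule mult_mat_vec_carrier[rotated])
  have d: "?d \<in> carrier_vec p" using e TYe by simp
  have step: "M *\<^sub>v ?d = M *\<^sub>v ?e - (M * T * Y) *\<^sub>v ?e" if M: "M \<in> carrier_mat q p" for M
    using mult_minus_distrib_mat_vec[OF M e TYe] assoc_mult_mat_vec[OF M TY e]
      assoc_mult_mat[OF M T Y] by simp
  have "Y *\<^sub>v ?d = 0\<^sub>v q"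
    using step[OF Y] YTY mult_mat_vec_carrier[OF Y e] by simp
  then have "X *\<^sub>v ?d = 0\<^sub>v q"
    using N X Y d by (auto simp: mat_kernel[OF X] mat_kernel[OF Y])
  then have 0: "X *\<^sub>v ?e - (X * T * Y) *\<^sub>v ?e = 0\<^sub>v q" using step[OF X] by simp
  have XTY: "X * T * Y \<in> carrier_mat q p" using X T Y by auto
  have "col X j - col (X * T * Y) j = 0\<^sub>v q"
    using 0 by (simp add: mult_unit_vec_col[OF X j] mult_unit_vec_col[OF XTY j])
  then have "(col X j - col (X * T * Y) j) $ i = 0" using i by simp
  then have "X $$ (i, j) = col (X * T * Y) j $ i" using X XTY i j by simp
  also have "\<dots> = (X * T * Y) $$ (i, j)"
    by (rule index_col) (use XTY i j in auto)
  finally show "(X * T * Y) $$ (i, j) = X $$ (i, j)" ..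
qed (use X Y T in auto)

lemma is_outer_inverse_unique:
  assumes T: "T \<in> carrier_tensor p q n" and n: "0 < n"
    and X: "is_outer_inverse T B C X" and Y: "is_outer_inverse T B C Y"
  shows "X = Y"
proof -
  note dT = carrier_tensor_dims[OF T n]
  have cX: "X \<in> carrier_tensor q p n" and cY: "Y \<in> carrier_tensor q p n"
    using X Y by (auto simp: is_outer_inverse_def dT)
  note bX = bcirc_carrier[OF cX n] and bY = bcirc_carrier[OF cY n] and bT = bcirc_carrier[OF T n]
  have outer: "bcirc Z * bcirc T * bcirc Z = bcirc Z"
    if "Z \<in> carrier_tensor q p n" "is_outer_inverse T B C Z" for Z
    using that t_prod_props[OF that(1) T n] t_prod_props[OF _ that(1) n, of "Z *\<^sub>t T" q]
    by (simp add: is_outer_inverse_def)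
  have R: "t_range X = t_range Y" and N: "mat_kernel (bcirc X) = mat_kernel (bcirc Y)"
    using X Y by (simp_all add: is_outer_inverse_def t_null_def)
  have "bcirc Y * bcirc T * bcirc X = bcirc X"
  proof (rule outer_absorb_left[OF bX bY bT outer[OF cY Y]])
    fix x :: "complex vec" assume "x \<in> carrier_vec (p * n)"
    then have "bcirc X *\<^sub>v x \<in> t_range X" using bX by (auto simp: t_range_eq)
    then show "\<exists>y\<in>carrier_vec (p * n). bcirc X *\<^sub>v x = bcirc Y *\<^sub>v y"
      using R bY by (auto simp: t_range_eq)
  qed
  moreover have "bcirc Y * bcirc T * bcirc X = bcirc Y"
    by (rule outer_absorb_right[OF bY bX bT outer[OF cX X]]) (simp add: N)
  ultimately show ?thesis using bcirc_inj[OF cX cY n] by simp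
qed

lemma outer_inverse_eqI:
  assumes "T \<in> carrier_tensor p q n" "0 < n" "is_outer_inverse T B C X"
  shows "outer_inverse T B C = X"
  unfolding outer_inverse_def using assms is_outer_inverse_unique by blast

end

theory Submission
  imports Defs
begin

text \<open>If \<open>B * Z * C * T * B = B\<close> and \<open>C * T * B * Z * C = C\<close>, then \<open>X = B * Z * C\<close> is
  the outer inverse of \<open>T\<close> with the range of \<open>B\<close> and the null space of \<open>C\<close>
  (\<open>is_outer_inverse_sandwich\<close>). By associativity, the first identity says
  \<open>X * T * B = B\<close> and the second says \<open>C * T * X = C\<close>. Multiplying the first on the right by
  \<open>Z * C\<close> yields \<open>X * T * X = X\<close>. Moreover \<open>X\<close> is a right multiple of \<open>B\<close> and \<open>B\<close> is a right
  multiple of \<open>X\<close>, so the two have the same range; dually \<open>X\<close> and \<open>C\<close> are left multiples of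
  each other, so they have the same null space.

  Assumption \<open>f\<close> is exactly the hypothesis of this construction for the given \<open>{1}\<close>-inverse
  \<open>G\<close>, while any other \<open>Z\<close> in the conclusion satisfies it by assumption. Since an outer
  inverse with prescribed range and null space is unique, \<open>B * G * C\<close> and \<open>B * Z * C\<close> agree.\<close>

text \<open>\<open>bcirc\<close> is injective and turns the \<open>t\<close>-product into the matrix product, so
  algebraic laws of matrices transfer to tensors.\<close>

lemma t_prod_assoc:
  assumes A: "A \<in> carrier_tensor a b n" and B: "B \<in> carrier_tensor b c n"
    and C: "C \<in> carrier_tensor c d n" and n: "0 < n"
  shows "A *\<^sub>t B *\<^sub>t C = A *\<^sub>t (B *\<^sub>t C)"
proof -
  note AB = t_prod_props[OF A B n] and BC = t_prod_props[OF B C n]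
  note L = t_prod_props[OF AB(1) C n] and R = t_prod_props[OF A BC(1) n]
  have "bcirc (A *\<^sub>t B *\<^sub>t C) = bcirc (A *\<^sub>t (B *\<^sub>t C))"
    unfolding L(2) R(2) AB(2) BC(2)
    by (rule assoc_mult_mat[OF bcirc_carrier[OF A n] bcirc_carrier[OF B n] bcirc_carrier[OF C n]])
  then show ?thesis by (rule bcirc_inj[OF L(1) R(1) n])
qed

lemma t_range_prod_subset:
  assumes A: "A \<in> carrier_tensor a b n" and B: "B \<in> carrier_tensor b c n" and n: "0 < n"
  shows "t_range (A *\<^sub>t B) \<subseteq> t_range A"
proof
  note bA = bcirc_carrier[OF A n] and bB = bcirc_carrier[OF B n]
  fix y assume "y \<in> t_range (A *\<^sub>t B)"
  then obtain x where x: "x \<in> carrier_vec (c * n)" and y: "y = (bcirc A * bcirc B) *\<^sub>v x"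
    using bB by (auto simp: t_range_eq t_prod_props[OF A B n])
  have "y = bcirc A *\<^sub>v (bcirc B *\<^sub>v x)"
    unfolding y by (rule assoc_mult_mat_vec[OF bA bB x])
  moreover have "bcirc B *\<^sub>v x \<in> carrier_vec (b * n)" using bB x by simp
  ultimately show "y \<in> t_range A" using bA by (auto simp: t_range_eq)
qed

lemma t_null_subset_prod:
  assumes A: "A \<in> carrier_tensor a b n" and B: "B \<in> carrier_tensor b c n" and n: "0 < n"
  shows "t_null B \<subseteq> t_null (A *\<^sub>t B)"
proof
  note bA = bcirc_carrier[OF A n] and bB = bcirc_carrier[OF B n]
  fix x assume "x \<in> t_null B"
  then have x: "x \<in> carrier_vec (c * n)" "bcirc B *\<^sub>v x = 0\<^sub>v (b * n)"
    by (auto simp: t_null_def mat_kernel[OF bB])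
  have "(bcirc A * bcirc B) *\<^sub>v x = bcirc A *\<^sub>v 0\<^sub>v (b * n)"
    using assoc_mult_mat_vec[OF bA bB x(1)] x(2) by simp
  also have "\<dots> = 0\<^sub>v (a * n)" using bA by auto
  finally show "x \<in> t_null (A *\<^sub>t B)"
    using x(1) by (simp add: t_null_def t_prod_props[OF A B n] mat_kernel[OF mult_carrier_mat[OF bA bB]])
qed

text \<open>This applies to every \<open>Z\<close> with the two identities, whether or not it is a
  \<open>{1}\<close>-inverse of \<open>C * T * B\<close>; that is what lets a single uniqueness argument compare
  \<open>B * G * C\<close> with \<open>B * Z * C\<close>.\<close>

lemma is_outer_inverse_sandwich:
  assumes n: "0 < n"
    and T: "T \<in> carrier_tensor p q n" and B: "B \<in> carrier_tensor q k n"
    and C: "C \<in> carrier_tensor s p n" and Z: "Z \<in> carrier_tensor k s n"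
    and cancel_B: "B *\<^sub>t Z *\<^sub>t C *\<^sub>t T *\<^sub>t B = B"
    and cancel_C: "C *\<^sub>t T *\<^sub>t B *\<^sub>t Z *\<^sub>t C = C"
  shows "is_outer_inverse T B C (B *\<^sub>t Z *\<^sub>t C)"
proof -
  define X where "X = B *\<^sub>t Z *\<^sub>t C"
  note BZ = t_prod_props(1)[OF B Z n] and ZC = t_prod_props(1)[OF Z C n]
    and CT = t_prod_props(1)[OF C T n] and TB = t_prod_props(1)[OF T B n]
  have X: "X \<in> carrier_tensor q p n"
    unfolding X_def by (rule t_prod_props(1)[OF BZ C n])
  have XT: "X *\<^sub>t T \<in> carrier_tensor q q n" by (rule t_prod_props(1)[OF X T n])
  have X_eq: "X = B *\<^sub>t (Z *\<^sub>t C)"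
    unfolding X_def by (rule t_prod_assoc[OF B Z C n])
  have XTB: "X *\<^sub>t T *\<^sub>t B = B" using cancel_B by (simp add: X_def)
  have B_eq: "X *\<^sub>t (T *\<^sub>t B) = B"
    using XTB t_prod_assoc[OF X T B n] by simp
  have C_eq: "C *\<^sub>t T *\<^sub>t X = C"
    using cancel_C t_prod_assoc[OF CT B Z n] t_prod_assoc[OF CT BZ C n] by (simp add: X_def)
  have "X *\<^sub>t T *\<^sub>t X = X *\<^sub>t T *\<^sub>t B *\<^sub>t (Z *\<^sub>t C)"
    unfolding X_eq using t_prod_assoc[OF XT B ZC n] by (simp add: X_eq)
  also have "\<dots> = X" by (simp add: XTB X_eq[symmetric])
  finally have outer: "X *\<^sub>t T *\<^sub>t X = X" .
  have range: "t_range X = t_range B"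
    using t_range_prod_subset[OF B ZC n] t_range_prod_subset[OF X TB n]
    by (simp add: B_eq X_eq[symmetric])
  have null: "t_null X = t_null C"
    using t_null_subset_prod[OF BZ C n] t_null_subset_prod[OF CT X n]
    by (simp add: C_eq X_def[symmetric])
  show ?thesis
    using X outer range null
    by (simp add: is_outer_inverse_def carrier_tensor_dims[OF T n] X_def[symmetric])
qed

theorem theorem3p11:
  fixes p q k s n :: nat and T B C G :: tensor
  assumes n: "0 < n"
    and T: "T \<in> carrier_tensor p q n"
    and B: "B \<in> carrier_tensor q k n"
    and C: "C \<in> carrier_tensor s p n"
    and G: "is_one_inverse (C *\<^sub>t T *\<^sub>t B) G"
    and a: "\<exists>X \<in> carrier_tensor q p n. is_outer_inverse T B C X"
    and b: "\<exists>U \<in> carrier_tensor k s n. \<exists>V \<in> carrier_tensor k s n.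
              B *\<^sub>t U *\<^sub>t C *\<^sub>t T *\<^sub>t B = B \<and> C *\<^sub>t T *\<^sub>t B *\<^sub>t V *\<^sub>t C = C"
    and c: "\<exists>Y \<in> carrier_tensor k p n. \<exists>W \<in> carrier_tensor q s n.
              B *\<^sub>t Y *\<^sub>t T *\<^sub>t B = B \<and> C *\<^sub>t T *\<^sub>t W *\<^sub>t C = C \<and> B *\<^sub>t Y = W *\<^sub>t C"
    and d: "\<exists>U \<in> carrier_tensor k p n. \<exists>V \<in> carrier_tensor q s n.
              C *\<^sub>t T *\<^sub>t B *\<^sub>t U = C \<and> V *\<^sub>t C *\<^sub>t T *\<^sub>t B = B"
    and e: "t_range (C *\<^sub>t T *\<^sub>t B) = t_range C \<and> t_null (C *\<^sub>t T *\<^sub>t B) = t_null B"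
    and f: "B *\<^sub>t G *\<^sub>t C *\<^sub>t T *\<^sub>t B = B \<and> C *\<^sub>t T *\<^sub>t B *\<^sub>t G *\<^sub>t C = C"
    and g: "t_rank (C *\<^sub>t T *\<^sub>t B) = t_rank B \<and> t_rank B = t_rank C"
  shows "outer_inverse T B C = B *\<^sub>t G *\<^sub>t C \<and>
    (\<forall>Z \<in> carrier_tensor k s n.
       B *\<^sub>t Z *\<^sub>t C *\<^sub>t T *\<^sub>t B = B \<and> C *\<^sub>t T *\<^sub>t B *\<^sub>t Z *\<^sub>t C = C \<longrightarrow>
       B *\<^sub>t G *\<^sub>t C = B *\<^sub>t Z *\<^sub>t C)"
proof -
  have "C *\<^sub>t T *\<^sub>t B \<in> carrier_tensor s k n"
    by (rule t_prod_props(1)[OF t_prod_props(1)[OF C T n] B n])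
  then have G_carrier: "G \<in> carrier_tensor k s n"
    using G by (simp add: is_one_inverse_def carrier_tensor_dims[OF _ n])
  have formula: "outer_inverse T B C = B *\<^sub>t Z *\<^sub>t C"
    if "Z \<in> carrier_tensor k s n"
      "B *\<^sub>t Z *\<^sub>t C *\<^sub>t T *\<^sub>t B = B" "C *\<^sub>t T *\<^sub>t B *\<^sub>t Z *\<^sub>t C = C" for Z
    by (rule outer_inverse_eqI[OF T n is_outer_inverse_sandwich[OF n T B C that]])
  have "outer_inverse T B C = B *\<^sub>t G *\<^sub>t C"
    using formula[OF G_carrier] f by simp
  with formula show ?thesis by metis
qed

end
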